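(* For each $k\in\mathbb Z$ let $\mathcal F_k$ be a closed subspace of $\mathcal U_k$ and let $\omega_k=\begin{bmatrix}\omega_{k,1}\\ \omega_{k,2}\end{bmatrix}:\mathcal F_k\to\begin{bmatrix}\mathcal Y_k\\ \mathcal U_{k-1}\end{bmatrix}$ be a contraction. Choose $Z^{(1)}=[Z^{(1)}_{j,k}]_{j,k\in\mathbb Z}\in\mathbb{UM}^\infty(\mathbf U,\mathbf Y)$ and $Z^{(2)}=[Z^{(2)}_{j,k}]_{j,k\in\mathbb Z}\in\mathbb{UM}^\infty_0(\mathbf U)$ such that $$\|Z^{(1)}u\|^2+\|Z^{(2)}u\|^2\le\|u\|^2\quad(u\in\mathbf U)$$ and, for all $j,k\in\mathbb Z$, $$Z^{(1)}_{j,k}|_{\mathcal F_k}=\begin{cases}\omega_{k,1},& j=k,\\ 0,& j\ne k,\end{cases}\qquad Z^{(2)}_{j,k}|_{\mathcal F_k}=\begin{cases}\omega_{k,2},& j=k-1,\\ 0,& j\neq k-1.\end{cases}$$ Then $H=Z^{(1)}(I_{\mathbf U}-Z^{(2)})^{-1}$ is a well-defined upper triangular operator matrix, $H$ belongs to $\mathbb{UM}^2_{\mathrm{ball}}(\mathbf U,\mathbf Y)$, and $H$ satisfies the interpolation conditions $$H_{k,k}|_{\mathcal F_k}=\omega_{k,1}\quad(k\in\mathbb Z),\qquad H_{j,k}|_{\mathcal F_k}=H_{j,k-1}\omega_{k,2}\quad(j,k\in\mathbb Z,\ j<k).$$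
   Context: For each $k\in\mathbb Z$, $\mathcal U_k$ and $\mathcal Y_k$ are Hilbert spaces; $\mathbf U=\oplus_{k\in\mathbb Z}\mathcal U_k$ and $\mathbf Y=\oplus_{k\in\mathbb Z}\mathcal Y_k$ are the Hilbert direct sums. $\mathbb{UM}(\mathbf U,\mathbf Y)$ is the set of all upper triangular operator matrices $H=[H_{j,k}]_{j,k\in\mathbb Z}$, where $H_{j,k}:\mathcal U_k\to\mathcal Y_j$ is a bounded operator and $H_{j,k}=0$ for $k<j$. $\mathbb{UM}^2_{\mathrm{ball}}(\mathbf U,\mathbf Y)$ is the set of $H\in\mathbb{UM}(\mathbf U,\mathbf Y)$ with $\sum_{j=-\infty}^k\|H_{j,k}u_k\|^2\le\|u_k\|^2$ for all $u_k\in\mathcal U_k$ and all $k\in\mathbb Z$ (i.e. each column induces a contraction $\mathcal U_k\to\mathbf Y$). $\mathbb{UM}^\infty(\mathbf U,\mathbf Y)$ is the set of $H\in\mathbb{UM}(\mathbf U,\mathbf Y)$ that induce bounded operators $\mathbf U\to\mathbf Y$; $\mathbb{UM}^\infty_0(\mathbf U,\mathbf Y)$ is the subset of strictly upper triangular ones ($H_{j,k}=0$ for $k\le j$). When $\mathbf U=\mathbf Y$ one writes $(\mathbf U)$ in place of $(\mathbf U,\mathbf U)$. Products of upper triangular operator matrices are the usual (entrywise) matrix products, which involve only finite sums; $\mathbb{UM}(\mathbf U)$ is an algebra with unit $I_{\mathbf U}$, and inverses are taken in this algebra (they need not induce bounded operators); $M\in\mathbb{UM}(\mathbf U)$ is invertible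 in $\mathbb{UM}(\mathbf U)$ if and only if every diagonal entry $M_{j,j}$ is invertible on $\mathcal U_j$. *)

theory Defs
  imports "HOL-Analysis.Analysis" "HOL-Algebra.Group"
begin

text \<open>
  Hilbert spaces are complex.  The library has only real inner product spaces, so a complex inner
  product is added on top of \<^class>\<open>real_inner\<close>, whose inner product is its real part; in
  particular the norm is the one given by the complex inner product.
\<close>

class complex_inner = real_inner +
  fixes scaleC :: "complex \<Rightarrow> 'a \<Rightarrow> 'a"
    and cinner :: "'a \<Rightarrow> 'a \<Rightarrow> complex"
  assumes scaleC_add_right: "scaleC a (x + y) = scaleC a x + scaleC a y"
    and scaleC_add_left: "scaleC (a + b) x = scaleC a x + scaleC b x"
    and scaleC_scaleC: "scaleC a (scaleC b x) = scaleC (a * b) x"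
    and scaleC_of_real: "scaleC (complex_of_real r) x = scaleR r x"
    and cinner_commute: "cinner x y = cnj (cinner y x)"
    and cinner_add_left: "cinner (x + y) z = cinner x z + cinner y z"
    and cinner_scaleC_left: "cinner (scaleC a x) y = a * cinner x y"
    and Re_cinner: "Re (cinner x y) = inner x y"

class hilbert_space = complex_inner + complete_space

global_interpretation complex_vector: vector_space "scaleC :: complex \<Rightarrow> 'a \<Rightarrow> 'a::complex_inner"
proof
  show "scaleC 1 x = x" for x :: 'a
    using scaleC_of_real[of 1 x] by simp
qed (simp_all add: scaleC_add_right scaleC_add_left scaleC_scaleC)

instantiation complex :: hilbert_space
begin

definition scaleC_complex :: "complex \<Rightarrow> complex \<Rightarrow> complex"
  where "scaleC_complex a x = a * x"

definition cinner_complex :: "complex \<Rightarrow> complex \<Rightarrow> complex"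
  where "cinner_complex x y = x * cnj y"

instance
  by standard
    (auto simp: scaleC_complex_def cinner_complex_def algebra_simps inner_complex_def
      scaleR_conv_of_real)

end

instantiation prod :: (hilbert_space, hilbert_space) hilbert_space
begin

definition scaleC_prod :: "complex \<Rightarrow> 'a \<times> 'b \<Rightarrow> 'a \<times> 'b"
  where "scaleC_prod a x = (scaleC a (fst x), scaleC a (snd x))"

definition cinner_prod :: "'a \<times> 'b \<Rightarrow> 'a \<times> 'b \<Rightarrow> complex"
  where "cinner_prod x y = cinner (fst x) (fst y) + cinner (snd x) (snd y)"

instance
proof
  fix x y :: "'a \<times> 'b"
  show "cinner x y = cnj (cinner y x)"
    unfolding cinner_prod_def complex_cnj_add
    by (metis cinner_commute)
qed (auto simp: scaleC_prod_def cinner_prod_def scaleC_add_right scaleC_add_left scaleC_scaleC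
      scaleC_of_real cinner_add_left cinner_scaleC_left Re_cinner inner_prod_def
      algebra_simps scaleR_prod_def)

end

text \<open>
  A family of Hilbert spaces indexed by the integers is a family of closed subspaces of one Hilbert
  space.  This is no restriction: every family of Hilbert spaces embeds isometrically
  into its Hilbert direct sum.  The subspaces are not assumed to be mutually orthogonal, or even distinct.
\<close>

definition closed_csubspace :: "'a::complex_inner set \<Rightarrow> bool"
  where "closed_csubspace S \<longleftrightarrow> complex_vector.subspace S \<and> closed S"

text \<open>
  Operators are extensional functions, so that equality of operators between subspaces is equality
  in HOL.
\<close>

definition bounded_operators ::
    "'a::complex_inner set \<Rightarrow> 'b::complex_inner set \<Rightarrow> ('a \<Rightarrow> 'b) set"
  where "bounded_operators X Y =
    {T \<in> X \<rightarrow>\<^sub>E Y.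
      (\<forall>x\<in>X. \<forall>y\<in>X. T (x + y) = T x + T y) \<and>
      (\<forall>c. \<forall>x\<in>X. T (scaleC c x) = scaleC c (T x)) \<and>
      (\<exists>C. \<forall>x\<in>X. norm (T x) \<le> C * norm x)}"

definition contractions ::
    "'a::complex_inner set \<Rightarrow> 'b::complex_inner set \<Rightarrow> ('a \<Rightarrow> 'b) set"
  where "contractions X Y = {T \<in> bounded_operators X Y. \<forall>x\<in>X. norm (T x) \<le> norm x}"

text \<open>The Hilbert direct sum of a family of Hilbert spaces, and its norm.\<close>

definition hilbert_sum :: "(int \<Rightarrow> 'a::hilbert_space set) \<Rightarrow> (int \<Rightarrow> 'a) set"
  where "hilbert_sum U = {x. (\<forall>k. x k \<in> U k) \<and> (\<lambda>k. (norm (x k))\<^sup>2) summable_on UNIV}"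

definition hilbert_sum_norm :: "(int \<Rightarrow> 'a::hilbert_space) \<Rightarrow> real"
  where "hilbert_sum_norm x = sqrt (\<Sum>\<^sub>\<infinity>k. (norm (x k))\<^sup>2)"

type_synonym ('a, 'b) op_matrix = "int \<Rightarrow> int \<Rightarrow> 'a \<Rightarrow> 'b"

text \<open>The entry \<open>H j k\<close> in row \<open>j\<close> and column \<open>k\<close> is an operator from \<open>U k\<close> to \<open>Y j\<close>.\<close>

definition UM ::
    "(int \<Rightarrow> 'a::hilbert_space set) \<Rightarrow> (int \<Rightarrow> 'b::hilbert_space set) \<Rightarrow> ('a, 'b) op_matrix set"
  where "UM U Y =
    {H. (\<forall>j k. H j k \<in> bounded_operators (U k) (Y j)) \<and>
        (\<forall>j k. k < j \<longrightarrow> (\<forall>u\<in>U k. H j k u = 0))}"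

definition UM2_ball ::
    "(int \<Rightarrow> 'a::hilbert_space set) \<Rightarrow> (int \<Rightarrow> 'b::hilbert_space set) \<Rightarrow> ('a, 'b) op_matrix set"
  where "UM2_ball U Y =
    {H \<in> UM U Y. \<forall>k. \<forall>u\<in>U k.
        (\<lambda>j. (norm (H j k u))\<^sup>2) summable_on {..k} \<and>
        (\<Sum>\<^sub>\<infinity>j\<in>{..k}. (norm (H j k u))\<^sup>2) \<le> (norm u)\<^sup>2}"

definition matrix_apply :: "('a::hilbert_space, 'b::hilbert_space) op_matrix \<Rightarrow> (int \<Rightarrow> 'a) \<Rightarrow> int \<Rightarrow> 'b"
  where "matrix_apply H x = (\<lambda>j. \<Sum>\<^sub>\<infinity>k. H j k (x k))"

text \<open>
  The summability condition is needed because \<^const>\<open>infsum\<close> is 0 for families that are not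
  summable.
\<close>

definition UM_inf ::
    "(int \<Rightarrow> 'a::hilbert_space set) \<Rightarrow> (int \<Rightarrow> 'b::hilbert_space set) \<Rightarrow> ('a, 'b) op_matrix set"
  where "UM_inf U Y =
    {H \<in> UM U Y.
        (\<forall>x\<in>hilbert_sum U. (\<forall>j. (\<lambda>k. H j k (x k)) summable_on UNIV) \<and>
           matrix_apply H x \<in> hilbert_sum Y) \<and>
        (\<exists>C. \<forall>x\<in>hilbert_sum U. hilbert_sum_norm (matrix_apply H x) \<le> C * hilbert_sum_norm x)}"

definition UM_inf0 ::
    "(int \<Rightarrow> 'a::hilbert_space set) \<Rightarrow> (int \<Rightarrow> 'b::hilbert_space set) \<Rightarrow> ('a, 'b) op_matrix set"
  where "UM_inf0 U Y = {H \<in> UM_inf U Y. \<forall>j k. k \<le> j \<longrightarrow> (\<forall>u\<in>U k. H j k u = 0)}"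

text \<open>
  The first argument is the family of domains of the right factor.  By triangularity all terms with
  index outside \<open>{j..k}\<close> of the sum giving the entry \<open>(j, k)\<close> of a product vanish.
\<close>

definition um_mult ::
    "(int \<Rightarrow> 'a set) \<Rightarrow> ('b, 'c::comm_monoid_add) op_matrix \<Rightarrow> ('a, 'b) op_matrix \<Rightarrow> ('a, 'c) op_matrix"
  where "um_mult U A B = (\<lambda>j k. \<lambda>u\<in>U k. \<Sum>i\<in>{j..k}. A j i (B i k u))"

definition um_id :: "(int \<Rightarrow> 'a::zero set) \<Rightarrow> ('a, 'a) op_matrix"
  where "um_id U = (\<lambda>j k. \<lambda>u\<in>U k. if j = k then u else 0)"

definition um_diff ::
    "(int \<Rightarrow> 'a set) \<Rightarrow> ('a, 'b::minus) op_matrix \<Rightarrow> ('a, 'b) op_matrix \<Rightarrow> ('a, 'b) op_matrix"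
  where "um_diff U A B = (\<lambda>j k. \<lambda>u\<in>U k. A j k u - B j k u)"

text \<open>
  The multiplicative monoid of the algebra of upper triangular matrices from \<open>U\<close> to \<open>U\<close>.  Its units
  and inverses are those of the algebra; the inverse of a unit need not induce a bounded operator.
\<close>

definition um_monoid :: "(int \<Rightarrow> 'a::hilbert_space set) \<Rightarrow> ('a, 'a) op_matrix monoid"
  where "um_monoid U = \<lparr>carrier = UM U U, mult = um_mult U, one = um_id U\<rparr>"

end

theory Submission
  imports Defs
begin

text \<open>
  Fix \<open>u \<in> U k\<close> and let \<open>x\<close> be column \<open>k\<close> of \<open>(I - Z2)\<^sup>-\<^sup>1\<close> applied to \<open>u\<close>, so that
  \<open>x = u e\<^sub>k + Z2 x\<close> and \<open>H e\<^sub>k u = Z1 x\<close> entrywise.  The sequence \<open>x\<close> need not be square summable,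
  but for every \<open>m \<le> k\<close> its truncation to \<open>{m..k}\<close> has, by triangularity, the same
  images as \<open>x\<close> in the rows \<open>j \<ge> m\<close>.  The norm inequality for the truncation
  therefore gives \<open>(\<Sum>j=m..k. \<parallel>H j k u\<parallel>\<^sup>2) + (\<Sum>j=m..k-1. \<parallel>x j\<parallel>\<^sup>2) \<le> \<parallel>u\<parallel>\<^sup>2 + (\<Sum>j=m..k-1. \<parallel>x j\<parallel>\<^sup>2)\<close>,
  and the finite sums over \<open>x\<close> cancel.
  The interpolation conditions are the columns of \<open>H = Z1 + H Z2\<close> restricted to \<open>F k\<close>.
\<close>

section \<open>Closed subspaces and bounded operators between them\<close>

lemma closed_csubspace_zero: "closed_csubspace X \<Longrightarrow> 0 \<in> X"
  and closed_csubspace_add: "closed_csubspace X \<Longrightarrow> x \<in> X \<Longrightarrow> y \<in> X \<Longrightarrow> x + y \<in> X"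
  and closed_csubspace_diff: "closed_csubspace X \<Longrightarrow> x \<in> X \<Longrightarrow> y \<in> X \<Longrightarrow> x - y \<in> X"
  and closed_csubspace_scale: "closed_csubspace X \<Longrightarrow> x \<in> X \<Longrightarrow> scaleC c x \<in> X"
  and closed_csubspace_sum: "closed_csubspace X \<Longrightarrow> (\<And>i. i \<in> I \<Longrightarrow> f i \<in> X) \<Longrightarrow> sum f I \<in> X"
  unfolding closed_csubspace_def
  by (auto intro: complex_vector.subspace_0 complex_vector.subspace_add
      complex_vector.subspace_diff complex_vector.subspace_scale complex_vector.subspace_sum)

lemma bounded_operators_ext: "T \<in> bounded_operators X Y \<Longrightarrow> T \<in> extensional X"
  and bounded_operators_mem: "T \<in> bounded_operators X Y \<Longrightarrow> x \<in> X \<Longrightarrow> T x \<in> Y"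
  and bounded_operators_add:
    "T \<in> bounded_operators X Y \<Longrightarrow> x \<in> X \<Longrightarrow> y \<in> X \<Longrightarrow> T (x + y) = T x + T y"
  and bounded_operators_scale:
    "T \<in> bounded_operators X Y \<Longrightarrow> x \<in> X \<Longrightarrow> T (scaleC c x) = scaleC c (T x)"
  by (auto simp: bounded_operators_def PiE_iff)

text \<open>The constant in the definition may be negative when the domain is trivial. Passing to
  its absolute value makes bounds of composed operators multiply, since that step multiplies an
  inequality by the outer constant.\<close>

lemma bounded_operators_bound:
  assumes "T \<in> bounded_operators X Y"
  obtains C where "C \<ge> 0" "\<And>x. x \<in> X \<Longrightarrow> norm (T x) \<le> C * norm x"
proof -
  obtain C where C: "\<And>x. x \<in> X \<Longrightarrow> norm (T x) \<le> C * norm x"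
    using assms unfolding bounded_operators_def by blast
  have "norm (T x) \<le> \<bar>C\<bar> * norm x" if "x \<in> X" for x
    using C[OF that] by (meson abs_ge_self mult_right_mono norm_ge_zero order_trans)
  then show ?thesis using that[of "\<bar>C\<bar>"] by simp
qed

lemma bounded_operators_zero:
  assumes "T \<in> bounded_operators X Y" "closed_csubspace X"
  shows "T 0 = 0"
  using bounded_operators_scale[OF assms(1) closed_csubspace_zero[OF assms(2)], of 0] by simp

lemma bounded_operators_diff:
  assumes "T \<in> bounded_operators X Y" "closed_csubspace X" "x \<in> X" "y \<in> X"
  shows "T (x - y) = T x - T y"
  using bounded_operators_add[OF assms(1) closed_csubspace_diff[OF assms(2-4)] assms(4)] by simp

lemma bounded_operators_sum:
  assumes "T \<in> bounded_operators X Y" "closed_csubspace X" "\<And>i. i \<in> I \<Longrightarrow> f i \<in> X"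
  shows "T (sum f I) = (\<Sum>i\<in>I. T (f i))"
  using assms(3)
proof (induction I rule: infinite_finite_induct)
  case (insert i I)
  then show ?case
    using bounded_operators_add[OF assms(1)] closed_csubspace_sum[OF assms(2), of I f] by simp
qed (simp_all add: bounded_operators_zero[OF assms(1,2)])

text \<open>A restricted function is \<open>undefined\<close> off \<open>X\<close>, so additivity
  and homogeneity of \<open>restrict T X\<close> hold only because \<open>X\<close> contains the
  sums and multiples at which it is evaluated.\<close>

lemma restrict_in_bounded_operators:
  assumes "closed_csubspace X"
    and "\<And>x. x \<in> X \<Longrightarrow> T x \<in> Y"
    and "\<And>x y. x \<in> X \<Longrightarrow> y \<in> X \<Longrightarrow> T (x + y) = T x + T y"
    and "\<And>c x. x \<in> X \<Longrightarrow> T (scaleC c x) = scaleC c (T x)"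
    and "\<And>x. x \<in> X \<Longrightarrow> norm (T x) \<le> C * norm x"
  shows "restrict T X \<in> bounded_operators X Y"
  using assms closed_csubspace_add[OF assms(1)] closed_csubspace_scale[OF assms(1)]
  by (auto simp: bounded_operators_def intro!: exI[of _ C])

lemma zero_in_bounded_operators:
  "closed_csubspace X \<Longrightarrow> closed_csubspace Y \<Longrightarrow> (\<lambda>x\<in>X. 0) \<in> bounded_operators X Y"
  by (rule restrict_in_bounded_operators[where C = 0]) (auto intro: closed_csubspace_zero)

lemma id_in_bounded_operators: "closed_csubspace X \<Longrightarrow> (\<lambda>x\<in>X. x) \<in> bounded_operators X X"
  by (rule restrict_in_bounded_operators[where C = 1]) auto

lemma comp_in_bounded_operators:
  assumes X: "closed_csubspace X"
    and T: "T \<in> bounded_operators X Y" and S: "S \<in> bounded_operators Y Z"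
  shows "(\<lambda>x\<in>X. S (T x)) \<in> bounded_operators X Z"
proof -
  obtain C where C: "C \<ge> 0" "\<And>x. x \<in> X \<Longrightarrow> norm (T x) \<le> C * norm x"
    using bounded_operators_bound[OF T] by blast
  obtain D where D: "D \<ge> 0" "\<And>x. x \<in> Y \<Longrightarrow> norm (S x) \<le> D * norm x"
    using bounded_operators_bound[OF S] by blast
  show ?thesis
  proof (rule restrict_in_bounded_operators[OF X])
    fix x assume x: "x \<in> X"
    have "norm (S (T x)) \<le> D * norm (T x)"
      by (rule D(2)[OF bounded_operators_mem[OF T x]])
    also have "\<dots> \<le> D * (C * norm x)"
      by (rule mult_left_mono[OF C(2)[OF x] D(1)])
    finally show "norm (S (T x)) \<le> (D * C) * norm x"
      by (simp add: mult.assoc)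
  qed (simp_all add: bounded_operators_mem[OF T] bounded_operators_mem[OF S]
      bounded_operators_add[OF T] bounded_operators_add[OF S]
      bounded_operators_scale[OF T] bounded_operators_scale[OF S])
qed

lemma diff_in_bounded_operators:
  assumes X: "closed_csubspace X" and Y: "closed_csubspace Y"
    and T: "T \<in> bounded_operators X Y" and S: "S \<in> bounded_operators X Y"
  shows "(\<lambda>x\<in>X. T x - S x) \<in> bounded_operators X Y"
proof -
  obtain C where C: "\<And>x. x \<in> X \<Longrightarrow> norm (T x) \<le> C * norm x"
    using bounded_operators_bound[OF T] by blast
  obtain D where D: "\<And>x. x \<in> X \<Longrightarrow> norm (S x) \<le> D * norm x"
    using bounded_operators_bound[OF S] by blast
  show ?thesis
  proof (rule restrict_in_bounded_operators[OF X])
    fix x assume x: "x \<in> X"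
    show "norm (T x - S x) \<le> (C + D) * norm x"
      using norm_triangle_ineq4[of "T x" "S x"] C[OF x] D[OF x] by (simp add: distrib_right)
    show "T x - S x \<in> Y"
      by (rule closed_csubspace_diff[OF Y bounded_operators_mem[OF T x]
            bounded_operators_mem[OF S x]])
    show "T (scaleC c x) - S (scaleC c x) = scaleC c (T x - S x)" for c
      unfolding bounded_operators_scale[OF T x] bounded_operators_scale[OF S x]
      by (rule complex_vector.scale_right_diff_distrib[symmetric])
    fix y assume y: "y \<in> X"
    show "T (x + y) - S (x + y) = (T x - S x) + (T y - S y)"
      unfolding bounded_operators_add[OF T x y] bounded_operators_add[OF S x y]
      by (rule add_diff_add)
  qed
qed

lemma sum_in_bounded_operators:
  assumes X: "closed_csubspace X" and Y: "closed_csubspace Y"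
    and T: "\<And>i. i \<in> I \<Longrightarrow> T i \<in> bounded_operators X Y"
  shows "(\<lambda>x\<in>X. \<Sum>i\<in>I. T i x) \<in> bounded_operators X Y"
proof -
  have "\<exists>C. \<forall>x\<in>X. norm (T i x) \<le> C * norm x" if "i \<in> I" for i
    using bounded_operators_bound[OF T[OF that]] by meson
  then obtain C where C: "\<And>i x. i \<in> I \<Longrightarrow> x \<in> X \<Longrightarrow> norm (T i x) \<le> C i * norm x"
    by metis
  show ?thesis
  proof (rule restrict_in_bounded_operators[OF X])
    fix x assume x: "x \<in> X"
    show "norm (\<Sum>i\<in>I. T i x) \<le> (\<Sum>i\<in>I. C i) * norm x"
      unfolding sum_distrib_right by (rule sum_norm_le) (rule C[OF _ x])
    show "(\<Sum>i\<in>I. T i x) \<in> Y"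
      by (rule closed_csubspace_sum[OF Y]) (rule bounded_operators_mem[OF T x])
    show "(\<Sum>i\<in>I. T i (scaleC c x)) = scaleC c (\<Sum>i\<in>I. T i x)" for c
      unfolding complex_vector.scale_sum_right
      by (rule sum.cong[OF refl]) (rule bounded_operators_scale[OF T x])
    fix y assume y: "y \<in> X"
    show "(\<Sum>i\<in>I. T i (x + y)) = (\<Sum>i\<in>I. T i x) + (\<Sum>i\<in>I. T i y)"
      unfolding sum.distrib[symmetric]
      by (rule sum.cong[OF refl]) (rule bounded_operators_add[OF T x y])
  qed
qed

section \<open>Products of upper triangular matrices and their monoid\<close>

lemma UM_operator: "A \<in> UM U V \<Longrightarrow> A j k \<in> bounded_operators (U k) (V j)"
  and UM_lower: "A \<in> UM U V \<Longrightarrow> k < j \<Longrightarrow> u \<in> U k \<Longrightarrow> A j k u = 0"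
  by (auto simp: UM_def)

lemma UM_mem: "A \<in> UM U V \<Longrightarrow> u \<in> U k \<Longrightarrow> A j k u \<in> V j"
  by (rule bounded_operators_mem[OF UM_operator])

text \<open>Entries are extensional, so their values on \<open>U k\<close> determine them;
  identities between matrices reduce to computations with vectors.\<close>

lemma UM_eqI:
  assumes "\<And>j k. A j k \<in> extensional (U k)" "\<And>j k. B j k \<in> extensional (U k)"
    and "\<And>j k u. u \<in> U k \<Longrightarrow> A j k u = B j k u"
  shows "A = B"
proof -
  have "A j k = B j k" for j k
    by (rule extensionalityI[OF assms])
  then show ?thesis by blast
qed

lemma um_mult_ext: "um_mult U A B j k \<in> extensional (U k)"
  by (simp add: um_mult_def)

lemma um_id_ext: "um_id U j k \<in> extensional (U k)"
  by (simp add: um_id_def)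

lemma UM_ext: "A \<in> UM U V \<Longrightarrow> A j k \<in> extensional (U k)"
  by (rule bounded_operators_ext[OF UM_operator])

lemma um_id_in_UM:
  assumes "\<And>k. closed_csubspace (U k)"
  shows "um_id U \<in> UM U U"
proof -
  have "um_id U j k \<in> bounded_operators (U k) (U j)" for j k
  proof (cases "j = k")
    case True
    then show ?thesis
      using id_in_bounded_operators[OF assms] by (simp add: um_id_def)
  next
    case False
    then show ?thesis
      using zero_in_bounded_operators[OF assms assms] by (simp add: um_id_def)
  qed
  then show ?thesis by (auto simp: UM_def um_id_def)
qed

lemma um_diff_in_UM:
  assumes "\<And>k. closed_csubspace (U k)" "\<And>k. closed_csubspace (V k)" "A \<in> UM U V" "B \<in> UM U V"
  shows "um_diff U A B \<in> UM U V"
  using diff_in_bounded_operators[OF assms(1,2) UM_operator[OF assms(3)] UM_operator[OF assms(4)]]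
    UM_lower[OF assms(3)] UM_lower[OF assms(4)]
  by (simp add: UM_def um_diff_def)

lemma um_mult_in_UM:
  assumes U: "\<And>k. closed_csubspace (U k)" and W: "\<And>k. closed_csubspace (W k)"
    and A: "A \<in> UM V W" and B: "B \<in> UM U V"
  shows "um_mult U A B \<in> UM U W"
proof -
  \<comment> \<open>The inner restriction gives each summand the form produced by
    \<open>comp_in_bounded_operators\<close>; on \<open>U k\<close> it changes nothing.\<close>
  have "(\<lambda>u\<in>U k. \<Sum>i\<in>{j..k}. (\<lambda>u\<in>U k. A j i (B i k u)) u) \<in> bounded_operators (U k) (W j)" for j k
    by (rule sum_in_bounded_operators[OF U W])
      (rule comp_in_bounded_operators[OF U UM_operator[OF B] UM_operator[OF A]])
  moreover have "(\<lambda>u\<in>U k. \<Sum>i\<in>{j..k}. (\<lambda>u\<in>U k. A j i (B i k u)) u) = um_mult U A B j k" for j k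
    by (auto simp: um_mult_def fun_eq_iff)
  \<comment> \<open>Below the diagonal the range \<open>{j..k}\<close> is empty, which gives
    triangularity.\<close>
  ultimately show ?thesis by (simp add: UM_def um_mult_def)
qed

text \<open>Both sides sum over the triangle \<open>j <= i <= l <= k\<close>, in different orders;
  linearity of \<open>A j i\<close> then takes the inner sum inside.\<close>

lemma um_mult_assoc:
  assumes V: "\<And>k. closed_csubspace (V k)" and W: "\<And>k. closed_csubspace (W k)"
    and A: "A \<in> UM W X" and B: "B \<in> UM V W" and C: "C \<in> UM U V"
  shows "um_mult U (um_mult V A B) C = um_mult U A (um_mult U B C)"
proof (rule UM_eqI[of _ U])
  fix j k u assume u: "u \<in> U k"
  let ?t = "\<lambda>i l. A j i (B i l (C l k u))"
  have "um_mult U (um_mult V A B) C j k u = (\<Sum>l\<in>{j..k}. \<Sum>i\<in>{j..l}. ?t i l)"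
    using u by (simp add: um_mult_def UM_mem[OF C])
  \<comment> \<open>Padding with zeros turns the triangle into a square, whose ranges are
    independent and can be swapped.\<close>
  also have "\<dots> = (\<Sum>l\<in>{j..k}. \<Sum>i\<in>{j..k}. if i \<le> l then ?t i l else 0)"
    by (intro sum.cong[OF refl] sum.mono_neutral_cong_left) auto
  also have "\<dots> = (\<Sum>i\<in>{j..k}. \<Sum>l\<in>{j..k}. if i \<le> l then ?t i l else 0)"
    by (rule sum.swap)
  also have "\<dots> = (\<Sum>i\<in>{j..k}. \<Sum>l\<in>{i..k}. ?t i l)"
    by (intro sum.cong[OF refl] sum.mono_neutral_cong_right) auto
  also have "\<dots> = (\<Sum>i\<in>{j..k}. A j i (\<Sum>l\<in>{i..k}. B i l (C l k u)))"
    using u by (simp add: bounded_operators_sum[OF UM_operator[OF A] W] UM_mem[OF B] UM_mem[OF C])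
  also have "\<dots> = um_mult U A (um_mult U B C) j k u"
    using u by (simp add: um_mult_def)
  finally show "um_mult U (um_mult V A B) C j k u = um_mult U A (um_mult U B C) j k u" .
qed (simp_all add: um_mult_ext)

lemma um_mult_id_left:
  assumes B: "B \<in> UM U V"
  shows "um_mult U (um_id V) B = B"
proof (rule UM_eqI[of _ U])
  fix j k u assume u: "u \<in> U k"
  have "um_mult U (um_id V) B j k u = (\<Sum>i\<in>{j..k}. if j = i then B i k u else 0)"
    using u by (simp add: um_mult_def um_id_def UM_mem[OF B])
  \<comment> \<open>For \<open>k < j\<close> the sum is empty, which agrees with the vanishing entry
    \<open>B j k\<close>.\<close>
  then show "um_mult U (um_id V) B j k u = B j k u"
    using UM_lower[OF B _ u] by auto
qed (simp_all add: um_mult_ext UM_ext[OF B])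

lemma um_mult_id_right:
  assumes U: "\<And>k. closed_csubspace (U k)" and B: "B \<in> UM U V"
  shows "um_mult U B (um_id U) = B"
proof (rule UM_eqI[of _ U])
  fix j k u assume u: "u \<in> U k"
  have "um_mult U B (um_id U) j k u = (\<Sum>i\<in>{j..k}. if i = k then B j i u else 0)"
    unfolding um_mult_def restrict_apply if_P[OF u]
    by (rule sum.cong[OF refl])
      (simp add: um_id_def u bounded_operators_zero[OF UM_operator[OF B] U])
  then show "um_mult U B (um_id U) j k u = B j k u"
    using UM_lower[OF B _ u] by auto
qed (simp_all add: um_mult_ext UM_ext[OF B])

text \<open>Makes the general facts on \<open>Units\<close> and \<open>inv\<close> available, so
  that the inverse in the theorem is a two-sided inverse within \<open>UM U U\<close>.\<close>

lemma monoid_um_monoid: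
  assumes U: "\<And>k. closed_csubspace (U k)"
  shows "Group.monoid (um_monoid U)"
proof (rule monoidI)
  show "x \<otimes>\<^bsub>um_monoid U\<^esub> y \<otimes>\<^bsub>um_monoid U\<^esub> z = x \<otimes>\<^bsub>um_monoid U\<^esub> (y \<otimes>\<^bsub>um_monoid U\<^esub> z)"
    if "x \<in> carrier (um_monoid U)" "y \<in> carrier (um_monoid U)" "z \<in> carrier (um_monoid U)" for x y z
    using that by (simp add: um_monoid_def um_mult_assoc[OF U U])
qed (simp_all add: um_monoid_def um_mult_in_UM[OF U U] um_id_in_UM[OF U] um_mult_id_left
    um_mult_id_right[OF U])

section \<open>Invertibility of unipotent matrices\<close>

text \<open>Column \<open>k\<close> of the right inverse of a unipotent matrix \<open>M\<close>, by back substitution.\<close>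

function back_subst :: "('a::ab_group_add, 'a) op_matrix \<Rightarrow> int \<Rightarrow> int \<Rightarrow> 'a \<Rightarrow> 'a" where
  "back_subst M j k u =
    (if k < j then 0
     else (if j = k then u else 0) - (\<Sum>i\<in>{j+1..k}. M j i (back_subst M i k u)))"
  by pat_completeness auto
termination by (relation "Wellfounded.measure (\<lambda>(M, j, k, u). nat (k - j + 1))") auto

declare back_subst.simps [simp del]

lemma back_subst_lower: "k < j \<Longrightarrow> back_subst M j k u = 0"
  by (subst back_subst.simps) simp

lemma back_subst_diag: "back_subst M k k u = u"
  by (subst back_subst.simps) simp

text \<open>Since \<open>M j j\<close> is the identity, row \<open>j\<close> of
  \<open>M R = I\<close> expresses \<open>R j k\<close> through the entries \<open>R i k\<close>
  with \<open>j < i <= k\<close>; this is the recursion of \<open>back_subst\<close>. Only finitely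
  many rows occur, so no norm condition on \<open>M\<close> arises.\<close>

lemma unipotent_right_inverse:
  assumes U: "\<And>k. closed_csubspace (U k)"
    and M: "M \<in> UM U U" and diag: "\<And>k u. u \<in> U k \<Longrightarrow> M k k u = u"
  shows "\<exists>R\<in>UM U U. (\<forall>k. \<forall>u\<in>U k. R k k u = u) \<and> um_mult U M R = um_id U"
proof (intro bexI conjI allI ballI)
  define R where "R = (\<lambda>j k. \<lambda>u\<in>U k. back_subst M j k u)"
  have op: "R j k \<in> bounded_operators (U k) (U j)" for j k
  \<comment> \<open>The recursion for row \<open>j\<close> uses only rows strictly closer to the
    diagonal, so boundedness propagates by induction on the distance \<open>k - j\<close>.\<close>
  proof (induction "nat (k - j)" arbitrary: j rule: less_induct)
    case less
    show ?case
    proof (cases "k < j")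
      case True
      then have "R j k = (\<lambda>u\<in>U k. 0)"
        by (auto simp: R_def back_subst_lower)
      then show ?thesis using zero_in_bounded_operators[OF U U] by simp
    next
      case False
      let ?T = "\<lambda>u\<in>U k. \<Sum>i\<in>{j+1..k}. (\<lambda>u\<in>U k. M j i (R i k u)) u"
      have "R i k \<in> bounded_operators (U k) (U i)" if "i \<in> {j+1..k}" for i
        using that by (intro less) auto
      then have "?T \<in> bounded_operators (U k) (U j)"
        by (intro sum_in_bounded_operators[OF U U]
            comp_in_bounded_operators[OF U _ UM_operator[OF M]])
      then have "(\<lambda>u\<in>U k. um_id U j k u - ?T u) \<in> bounded_operators (U k) (U j)"
        by (rule diff_in_bounded_operators[OF U U UM_operator[OF um_id_in_UM[OF U]]])
      moreover have "R j k = (\<lambda>u\<in>U k. um_id U j k u - ?T u)"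
      proof
        fix u
        show "R j k u = (\<lambda>u\<in>U k. um_id U j k u - ?T u) u"
          using False by (simp add: R_def um_id_def back_subst.simps[of M j k])
      qed
      ultimately show ?thesis by simp
    qed
  qed
  then show R: "R \<in> UM U U"
    by (auto simp: UM_def R_def back_subst_lower)
  show "R k k u = u" if "u \<in> U k" for k u
    using that by (simp add: R_def back_subst_diag)
  show "um_mult U M R = um_id U"
  proof (rule UM_eqI[of _ U])
    fix j k u assume u: "u \<in> U k"
    show "um_mult U M R j k u = um_id U j k u"
    proof (cases "k < j")
      case True
      then show ?thesis using u by (simp add: um_mult_def um_id_def)
    next
      case False
      have "um_mult U M R j k u = (\<Sum>i\<in>{j..k}. M j i (R i k u))"
        using u by (simp add: um_mult_def)
      also have "{j..k} = insert j {j+1..k}"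
        using False by auto
      also have "(\<Sum>i\<in>insert j {j+1..k}. M j i (R i k u)) =
          R j k u + (\<Sum>i\<in>{j+1..k}. M j i (R i k u))"
        using diag UM_mem[OF R u] by simp
      also have "\<dots> = um_id U j k u"
        using False u by (simp add: R_def um_id_def back_subst.simps[of M j k])
      finally show ?thesis .
    qed
  qed (simp_all add: um_mult_ext um_id_ext)
qed

text \<open>
  A right inverse \<open>R\<close> of \<open>M\<close> is again unipotent, so it has a right inverse itself, which must be \<open>M\<close>.
\<close>

lemma unipotent_in_Units:
  assumes U: "\<And>k. closed_csubspace (U k)"
    and M: "M \<in> UM U U" and diag: "\<And>k u. u \<in> U k \<Longrightarrow> M k k u = u"
  shows "M \<in> Units (um_monoid U)"
proof -
  obtain R where R: "R \<in> UM U U" and R_diag: "\<And>k u. u \<in> U k \<Longrightarrow> R k k u = u"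
    and MR: "um_mult U M R = um_id U"
    using unipotent_right_inverse[of U M, OF U M diag] by blast
  obtain S where S: "S \<in> UM U U" and RS: "um_mult U R S = um_id U"
    using unipotent_right_inverse[of U R, OF U R R_diag] by blast
  have "M = um_mult U M (um_mult U R S)"
    unfolding RS by (rule um_mult_id_right[OF U M, symmetric])
  also have "\<dots> = um_mult U (um_mult U M R) S"
    by (rule um_mult_assoc[OF U U M R S, symmetric])
  also have "\<dots> = S"
    unfolding MR by (rule um_mult_id_left[OF S])
  finally have "um_mult U R M = um_id U"
    using RS by simp
  with R MR M show ?thesis
    by (auto simp: Units_def um_monoid_def)
qed

section \<open>Finitely supported vectors as test vectors for the norm inequality\<close>

lemma finite_support_in_hilbert_sum:
  assumes "\<And>k. closed_csubspace (U k)" "finite I" "\<And>i. i \<in> I \<Longrightarrow> x i \<in> U i"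
  shows "(\<lambda>i. if i \<in> I then x i else 0) \<in> hilbert_sum U"
proof -
  have "(\<lambda>i. (norm (if i \<in> I then x i else 0))\<^sup>2) summable_on UNIV"
    by (rule iffD1[OF summable_on_cong_neutral summable_on_finite[OF assms(2)]]) auto
  then show ?thesis
    using assms closed_csubspace_zero by (auto simp: hilbert_sum_def)
qed

lemma hilbert_sum_norm_power2: "(hilbert_sum_norm x)\<^sup>2 = (\<Sum>\<^sub>\<infinity>k. (norm (x k))\<^sup>2)"
  by (simp add: hilbert_sum_norm_def infsum_nonneg)

lemma hilbert_sum_norm_finite_support:
  assumes "finite I"
  shows "(hilbert_sum_norm (\<lambda>i. if i \<in> I then x i else 0))\<^sup>2 = (\<Sum>i\<in>I. (norm (x i))\<^sup>2)"
proof -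
  have "(\<Sum>\<^sub>\<infinity>i. (norm (if i \<in> I then x i else 0))\<^sup>2) = (\<Sum>\<^sub>\<infinity>i\<in>I. (norm (x i))\<^sup>2)"
    by (rule infsum_cong_neutral) auto
  then show ?thesis using assms by (simp add: hilbert_sum_norm_power2)
qed

lemma sum_le_hilbert_sum_norm:
  assumes "x \<in> hilbert_sum U" "finite I"
  shows "(\<Sum>i\<in>I. (norm (x i))\<^sup>2) \<le> (hilbert_sum_norm x)\<^sup>2"
  unfolding hilbert_sum_norm_power2
  using assms by (intro finite_sum_le_infsum) (auto simp: hilbert_sum_def)

lemma matrix_apply_finite_support:
  assumes "\<And>k. closed_csubspace (U k)" "A \<in> UM U V" "finite I"
  shows "matrix_apply A (\<lambda>i. if i \<in> I then x i else 0) j = (\<Sum>i\<in>I. A j i (x i))"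
proof -
  have "matrix_apply A (\<lambda>i. if i \<in> I then x i else 0) j = (\<Sum>\<^sub>\<infinity>i\<in>I. A j i (x i))"
    unfolding matrix_apply_def
    using bounded_operators_zero[OF UM_operator[OF assms(2)] assms(1)]
    by (intro infsum_cong_neutral) auto
  then show ?thesis using assms(3) by simp
qed

text \<open>The extra terms \<open>m <= i < j\<close> vanish because \<open>A j i\<close> lies below
  the diagonal. Hence cutting a column off at row \<open>m\<close> does not alter its image in the
  rows \<open>j >= m\<close>.\<close>

lemma UM_sum_eq_um_mult:
  assumes A: "A \<in> UM V W" and B: "B \<in> UM U V" and "u \<in> U k" "m \<le> j"
  shows "(\<Sum>i\<in>{m..k}. A j i (B i k u)) = um_mult U A B j k u"
proof -
  have "(\<Sum>i\<in>{m..k}. A j i (B i k u)) = (\<Sum>i\<in>{j..k}. A j i (B i k u))"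
    using assms UM_lower[OF A _ UM_mem[OF B]] by (intro sum.mono_neutral_right) auto
  then show ?thesis using assms by (simp add: um_mult_def)
qed

section \<open>Distributivity of the product and the column estimate\<close>

lemma um_mult_diff_left:
  fixes A B :: "('a::hilbert_space, 'b::ab_group_add) op_matrix"
  assumes "C \<in> UM U V" "u \<in> U k"
  shows "um_mult U (um_diff V A B) C j k u = um_mult U A C j k u - um_mult U B C j k u"
  using assms by (simp add: um_mult_def um_diff_def UM_mem sum_subtractf)

lemma um_mult_diff_right:
  assumes "\<And>k. closed_csubspace (V k)" "A \<in> UM V W" "B \<in> UM U V" "C \<in> UM U V" "u \<in> U k"
  shows "um_mult U A (um_diff U B C) j k u = um_mult U A B j k u - um_mult U A C j k u"
  using assms
  by (simp add: um_mult_def um_diff_def UM_mem sum_subtractf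
      bounded_operators_diff[OF UM_operator[OF assms(2)] assms(1)])

lemma column_sum_le:
  assumes U: "\<And>k. closed_csubspace (U k)"
    and Z1: "Z1 \<in> UM_inf U Y" and Z2: "Z2 \<in> UM_inf0 U U"
    and contr: "\<And>u. u \<in> hilbert_sum U \<Longrightarrow>
           (hilbert_sum_norm (matrix_apply Z1 u))\<^sup>2 + (hilbert_sum_norm (matrix_apply Z2 u))\<^sup>2
             \<le> (hilbert_sum_norm u)\<^sup>2"
    and G: "G \<in> UM U U" and inv: "um_mult U (um_diff U (um_id U) Z2) G = um_id U"
    and u: "u \<in> U k" and m: "m \<le> k"
  shows "(\<Sum>j\<in>{m..k}. (norm (um_mult U Z1 G j k u))\<^sup>2) \<le> (norm u)\<^sup>2"
proof -
  have UM1: "Z1 \<in> UM U Y" and UM2: "Z2 \<in> UM U U"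
    using Z1 Z2 by (auto simp: UM_inf_def UM_inf0_def)
  define x where "x = (\<lambda>i. if i \<in> {m..k} then G i k u else 0)"
  have x: "x \<in> hilbert_sum U"
    unfolding x_def using UM_mem[OF G u] by (intro finite_support_in_hilbert_sum U) auto
  \<comment> \<open>This is \<open>(I - Z2) G = I\<close>, solved for \<open>Z2 G\<close>.\<close>
  have Z2G: "um_mult U Z2 G j k u = G j k u - um_id U j k u" for j
    using um_mult_diff_left[OF G u, of "um_id U" Z2 j] inv um_mult_id_left[OF G] by simp
  \<comment> \<open>The only term has \<open>i = k\<close>, and the diagonal of \<open>Z2\<close> is
    zero.\<close>
  have "um_mult U Z2 G k k u = 0"
    using Z2 u UM_mem[OF G u] by (auto simp: um_mult_def UM_inf0_def)
  then have Gkk: "G k k u = u"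
    using Z2G[of k] u by (simp add: um_id_def)
  have app1: "matrix_apply Z1 x j = um_mult U Z1 G j k u" if "m \<le> j" for j
    unfolding x_def using matrix_apply_finite_support[OF U UM1, of "{m..k}"]
      UM_sum_eq_um_mult[OF UM1 G u that] by simp
  have app2: "matrix_apply Z2 x j = um_mult U Z2 G j k u" if "m \<le> j" for j
    unfolding x_def using matrix_apply_finite_support[OF U UM2, of "{m..k}"]
      UM_sum_eq_um_mult[OF UM2 G u that] by simp
  \<comment> \<open>The sum stops at \<open>k - 1\<close>: in these rows \<open>Z2 G\<close> and
    \<open>G\<close> agree, while in row \<open>k\<close> the first is zero and the second gives
    \<open>u\<close>. That one row accounts for the norm of \<open>u\<close> in the final
    bound.\<close>
  let ?N = "\<Sum>j\<in>{m..k-1}. (norm (G j k u))\<^sup>2"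
  have "(\<Sum>j\<in>{m..k}. (norm (um_mult U Z1 G j k u))\<^sup>2) = (\<Sum>j\<in>{m..k}. (norm (matrix_apply Z1 x j))\<^sup>2)"
    by (simp add: app1)
  \<comment> \<open>The rows \<open>j < m\<close>, not covered by \<open>app1\<close>, contribute
    nonnegative terms and are dropped.\<close>
  also have "\<dots> \<le> (hilbert_sum_norm (matrix_apply Z1 x))\<^sup>2"
    using Z1 x by (intro sum_le_hilbert_sum_norm[of _ Y]) (auto simp: UM_inf_def)
  finally have le1: "(\<Sum>j\<in>{m..k}. (norm (um_mult U Z1 G j k u))\<^sup>2)
      \<le> (hilbert_sum_norm (matrix_apply Z1 x))\<^sup>2" .
  have "?N = (\<Sum>j\<in>{m..k-1}. (norm (matrix_apply Z2 x j))\<^sup>2)"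
    using u by (intro sum.cong) (auto simp: app2 Z2G um_id_def)
  also have "\<dots> \<le> (hilbert_sum_norm (matrix_apply Z2 x))\<^sup>2"
    using Z2 x by (intro sum_le_hilbert_sum_norm[of _ U]) (auto simp: UM_inf_def UM_inf0_def)
  finally have le2: "?N \<le> (hilbert_sum_norm (matrix_apply Z2 x))\<^sup>2" .
  have "{m..k} = insert k {m..k-1}"
    using m by auto
  then have "(hilbert_sum_norm x)\<^sup>2 = (norm u)\<^sup>2 + ?N"
    unfolding x_def by (subst hilbert_sum_norm_finite_support) (simp_all add: Gkk)
  with le1 le2 contr[OF x] show ?thesis by linarith
qed

text \<open>Every finite subset of \<open>{..k}\<close> lies in some interval \<open>{m..k}\<close>,
  so the interval bounds control all finite partial sums; as the terms are nonnegative, this gives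
  both summability and the bound on the infinite sum.\<close>

lemma UM2_ballI:
  assumes H: "H \<in> UM U Y"
    and le: "\<And>k u m. u \<in> U k \<Longrightarrow> m \<le> k \<Longrightarrow> (\<Sum>j\<in>{m..k}. (norm (H j k u))\<^sup>2) \<le> (norm u)\<^sup>2"
  shows "H \<in> UM2_ball U Y"
proof -
  have "(\<lambda>j. (norm (H j k u))\<^sup>2) summable_on {..k} \<and>
      (\<Sum>\<^sub>\<infinity>j\<in>{..k}. (norm (H j k u))\<^sup>2) \<le> (norm u)\<^sup>2" if u: "u \<in> U k" for k u
  proof -
    have fin: "(\<Sum>j\<in>J. (norm (H j k u))\<^sup>2) \<le> (norm u)\<^sup>2" if J: "finite J" "J \<subseteq> {..k}" for J
    proof -
      \<comment> \<open>Inserting \<open>k\<close> makes \<open>Min\<close> meaningful for empty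
        \<open>J\<close> and keeps the lower endpoint at most \<open>k\<close>.\<close>
      have "J \<subseteq> {Min (insert k J)..k}"
        using J by auto
      then have "(\<Sum>j\<in>J. (norm (H j k u))\<^sup>2) \<le> (\<Sum>j\<in>{Min (insert k J)..k}. (norm (H j k u))\<^sup>2)"
        by (intro sum_mono2) auto
      also have "\<dots> \<le> (norm u)\<^sup>2"
        using J by (intro le[OF u]) auto
      finally show ?thesis .
    qed
    have summable: "(\<lambda>j. (norm (H j k u))\<^sup>2) summable_on {..k}"
    proof (rule nonneg_bdd_above_summable_on)
      show "bdd_above (sum (\<lambda>j. (norm (H j k u))\<^sup>2) ` {J. J \<subseteq> {..k} \<and> finite J})"
        by (rule bdd_aboveI2[where M = "(norm u)\<^sup>2"]) (simp add: fin)
    qed simp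
    moreover have "(\<Sum>\<^sub>\<infinity>j\<in>{..k}. (norm (H j k u))\<^sup>2) \<le> (norm u)\<^sup>2"
      by (rule infsum_le_finite_sums[OF summable fin])
    ultimately show ?thesis by blast
  qed
  then show ?thesis using H by (simp add: UM2_ball_def)
qed

section \<open>The inverse of \<open>I - Z2\<close> and the interpolation conditions for
  \<open>H\<close>\<close>

theorem theorem0p1:
  fixes U :: "int \<Rightarrow> 'u::hilbert_space set"
    and Y :: "int \<Rightarrow> 'y::hilbert_space set"
    and F :: "int \<Rightarrow> 'u set"
    and \<omega> :: "int \<Rightarrow> 'u \<Rightarrow> 'y \<times> 'u"
    and Z1 :: "('u, 'y) op_matrix"
    and Z2 :: "('u, 'u) op_matrix"
  assumes "\<And>k. closed_csubspace (U k)"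
    and "\<And>k. closed_csubspace (Y k)"
    and "\<And>k. closed_csubspace (F k)"
    and "\<And>k. F k \<subseteq> U k"
    and "\<And>k. \<omega> k \<in> contractions (F k) (Y k \<times> U (k - 1))"
    and "Z1 \<in> UM_inf U Y"
    and "Z2 \<in> UM_inf0 U U"
    and "\<And>u. u \<in> hilbert_sum U \<Longrightarrow>
           (hilbert_sum_norm (matrix_apply Z1 u))\<^sup>2 + (hilbert_sum_norm (matrix_apply Z2 u))\<^sup>2
             \<le> (hilbert_sum_norm u)\<^sup>2"
    and "\<And>j k f. f \<in> F k \<Longrightarrow> Z1 j k f = (if j = k then fst (\<omega> k f) else 0)"
    and "\<And>j k f. f \<in> F k \<Longrightarrow> Z2 j k f = (if j = k - 1 then snd (\<omega> k f) else 0)"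
  shows "um_diff U (um_id U) Z2 \<in> Units (um_monoid U) \<and>
    (let H = um_mult U Z1 (inv\<^bsub>um_monoid U\<^esub> (um_diff U (um_id U) Z2)) in
       H \<in> UM U Y \<and>
       H \<in> UM2_ball U Y \<and>
       (\<forall>k. \<forall>f\<in>F k. H k k f = fst (\<omega> k f)) \<and>
       (\<forall>j k. j < k \<longrightarrow> (\<forall>f\<in>F k. H j k f = H j (k - 1) (snd (\<omega> k f)))))"
proof -
  note U = assms(1) and Y = assms(2)
  have UM1: "Z1 \<in> UM U Y" and UM2: "Z2 \<in> UM U U"
    using assms(6,7) by (auto simp: UM_inf_def UM_inf0_def)
  interpret monoid: Group.monoid "um_monoid U"
    by (rule monoid_um_monoid[OF U])
  define M where "M = um_diff U (um_id U) Z2"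
  define G where "G = inv\<^bsub>um_monoid U\<^esub> M"
  define H where "H = um_mult U Z1 G"
  have M: "M \<in> UM U U"
    unfolding M_def by (intro um_diff_in_UM U um_id_in_UM UM2)
  \<comment> \<open>Strict triangularity of \<open>Z2\<close> makes \<open>I - Z2\<close>
    unipotent.\<close>
  have "M k k u = u" if "u \<in> U k" for k u
    using that assms(7) by (simp add: M_def um_diff_def um_id_def UM_inf0_def)
  then have unit: "M \<in> Units (um_monoid U)"
    by (rule unipotent_in_Units[OF U M])
  have G: "G \<in> UM U U" and MG: "um_mult U M G = um_id U" and GM: "um_mult U G M = um_id U"
    using monoid.Units_inv_closed[OF unit] monoid.Units_r_inv[OF unit] monoid.Units_l_inv[OF unit]
    by (simp_all add: G_def um_monoid_def)
  have H: "H \<in> UM U Y"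
    unfolding H_def by (rule um_mult_in_UM[OF U Y UM1 G])
  have ball: "H \<in> UM2_ball U Y"
    using column_sum_le[OF U assms(6-8) G MG[unfolded M_def]]
    by (intro UM2_ballI[OF H]) (simp add: H_def)
  \<comment> \<open>Here \<open>G\<close> acts as a left inverse of \<open>M\<close>, whereas the
    column estimate used it as a right inverse.\<close>
  have HM: "um_mult U H M = Z1"
    unfolding H_def by (simp add: um_mult_assoc[OF U U UM1 G M] GM um_mult_id_right[OF U UM1])
  \<comment> \<open>Expanding \<open>H (I - Z2) = Z1\<close> gives
    \<open>H = Z1 + H Z2\<close>.\<close>
  have H_eq: "H j k u = Z1 j k u + um_mult U H Z2 j k u" if "u \<in> U k" for j k u
    using um_mult_diff_right[OF U H um_id_in_UM[OF U] UM2 that, of j]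
    by (simp add: HM[unfolded M_def] um_mult_id_right[OF U H])
  \<comment> \<open>On \<open>F k\<close> only row \<open>k - 1\<close> of column \<open>k\<close>
    of \<open>Z2\<close> survives, and this index lies in \<open>{j..k}\<close> exactly when
    \<open>j < k\<close>.\<close>
  have HZ2: "um_mult U H Z2 j k f = (if j < k then H j (k - 1) (snd (\<omega> k f)) else 0)"
    if f: "f \<in> F k" for j k f
  proof -
    have "um_mult U H Z2 j k f =
        (\<Sum>i\<in>{j..k}. H j i (if i = k - 1 then snd (\<omega> k f) else 0))"
      unfolding um_mult_def restrict_apply if_P[OF subsetD[OF assms(4) f]] assms(10)[OF f] ..
    also have "\<dots> = (\<Sum>i\<in>{j..k}. if i = k - 1 then H j (k - 1) (snd (\<omega> k f)) else 0)"
      by (rule sum.cong[OF refl]) (simp add: bounded_operators_zero[OF UM_operator[OF H] U])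
    finally show ?thesis by simp
  qed
  \<comment> \<open>In \<open>H = Z1 + H Z2\<close> on \<open>F k\<close>, the term
    \<open>H Z2\<close> vanishes on the diagonal and \<open>Z1\<close> vanishes off it, so each
    interpolation condition keeps one term.\<close>
  have "H k k f = fst (\<omega> k f)" if "f \<in> F k" for k f
    using H_eq[of f k k] HZ2[OF that] assms(4,9) that by auto
  moreover have "H j k f = H j (k - 1) (snd (\<omega> k f))" if "j < k" "f \<in> F k" for j k f
    using H_eq[of f k j] HZ2[OF that(2)] assms(4,9) that by auto
  ultimately show ?thesis
    using unit H ball by (simp add: Let_def H_def G_def M_def)
qed

end
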